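(* Let $S$ be an almost-symmetric numerical semigroup with minimal generating system $\{g_1,\ldots,g_e\}$, where $e\ge 2$ and $g_1<\ldots<g_e$. Let $F=\max(\mathbb{Z}\setminus S)$ and $n=|S\cap[0,F]|$. Then $S$ satisfies Wilf's conjecture, that is, $$F+1 \le e n.$$
   Context: $\mathbb{N}$ denotes the set of non-negative integers. A numerical semigroup is a submonoid $S$ of $(\mathbb{N},+)$ such that $\mathbb{N}\setminus S$ is finite; equivalently, $S=\langle g_1,\ldots,g_e\rangle=\{a_1g_1+\ldots+a_eg_e \mid a_i\in\mathbb{N}\}$ with $\gcd(g_1,\ldots,g_e)=1$. Every numerical semigroup has a unique minimal generating system (a generating set no proper subset of which generates $S$), and its cardinality $e$ is the embedding dimension of $S$. $F$ is the Frobenius number of $S$, and $n$ is the number of elements of $S$ less than $F$. The set of pseudo-Frobenius numbers of $S$ is $PF(S)=\{\omega\in\mathbb{Z}\setminus S \mid \omega+s\in S \text{ for every } s\in S\setminus\{0\}\}$. $S$ is almost-symmetric if, for every integer $x\notin S$, either $F-x\in S$ or $\{x,F-x\}\subseteq PF(S)$. *)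

theory Defs
  imports Main
begin

definition numerical_semigroup :: "nat set \<Rightarrow> bool" where
  "numerical_semigroup S \<longleftrightarrow>
     0 \<in> S \<and> (\<forall>x\<in>S. \<forall>y\<in>S. x + y \<in> S) \<and> finite (UNIV - S)"

text \<open>Only finite subsets of \<open>A\<close> contribute, so that \<open>A\<close> itself may be infinite; for finite
  \<open>A\<close> these are all combinations of the elements of \<open>A\<close>, as coefficients may be 0.\<close>

definition submonoid_span :: "nat set \<Rightarrow> nat set" where
  "submonoid_span A = {\<Sum>x\<in>B. a x * x | a B. finite B \<and> B \<subseteq> A}"

definition minimal_generating_system :: "nat set \<Rightarrow> nat set \<Rightarrow> bool" where
  "minimal_generating_system A S \<longleftrightarrow>
     submonoid_span A = S \<and> (\<forall>B. B \<subset> A \<longrightarrow> submonoid_span B \<noteq> S)"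

text \<open>The complement of \<open>S\<close> is taken in the integers, so it is infinite and \<open>Max\<close> does not apply.\<close>

definition frobenius_number :: "nat set \<Rightarrow> int" where
  "frobenius_number S = (GREATEST x. x \<notin> int ` S)"

definition pseudo_frobenius :: "nat set \<Rightarrow> int set" where
  "pseudo_frobenius S = {w. w \<notin> int ` S \<and> (\<forall>s\<in>S - {0}. w + int s \<in> int ` S)}"

definition almost_symmetric :: "nat set \<Rightarrow> bool" where
  "almost_symmetric S \<longleftrightarrow>
     (\<forall>x::int. x \<notin> int ` S \<longrightarrow>
        frobenius_number S - x \<in> int ` S \<or>
        {x, frobenius_number S - x} \<subseteq> pseudo_frobenius S)"

lemma frobenius_number_greatest:
  assumes "numerical_semigroup S"
  shows "frobenius_number S \<notin> int ` S"
    and "x \<notin> int ` S \<Longrightarrow> x \<le> frobenius_number S"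
proof -
  let ?M = "Max (insert (- 1) (int ` (UNIV - S)))"
  have fin: "finite (insert (- 1) (int ` (UNIV - S)))"
    using assms by (simp add: numerical_semigroup_def)
  have "?M \<in> insert (- 1) (int ` (UNIV - S))"
    using fin by (intro Max_in) auto
  hence nin: "?M \<notin> int ` S" by auto
  have ub: "y \<le> ?M" if y: "y \<notin> int ` S" for y
  proof (cases "y < 0")
    case True
    moreover have "- 1 \<le> ?M" using fin by (intro Max_ge) auto
    ultimately show ?thesis by linarith
  next
    case False
    then obtain k where k: "y = int k" by (metis nonneg_int_cases not_less)
    with y have "y \<in> int ` (UNIV - S)" by auto
    thus ?thesis using fin by (intro Max_ge) auto
  qed
  have eq: "frobenius_number S = ?M"
    unfolding frobenius_number_def using nin ub by (intro Greatest_equality) auto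
  show "frobenius_number S \<notin> int ` S" using nin eq by simp
  show "x \<notin> int ` S \<Longrightarrow> x \<le> frobenius_number S" using ub eq by simp
qed

end

theory Submission
  imports Defs
begin

text \<open>
  Let \<open>L\<close> be the set of integers \<open>x\<close> with neither \<open>x\<close> nor \<open>F - x\<close> in \<open>S\<close>. Reflection in \<open>F\<close> matches
  the \<open>n\<close> elements of \<open>S\<close> in \<open>{0..F}\<close> with the gaps outside \<open>L\<close>, so \<open>F + 1 = 2 n + |L|\<close>
  (\<open>frobenius_number_eq_two_card_plus_card_unpaired\<close>), and Wilf's inequality becomes
  \<open>|L| \<le> (e - 2) n\<close> (\<open>card_unpaired_le\<close>).

  Almost-symmetry says that \<open>L\<close> consists of pseudo-Frobenius numbers. Let \<open>y < z\<close> be the two smallest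
  generators and let \<open>f \<in> L\<close>. Then \<open>f + y \<in> S\<close>, and a factorization of \<open>f + y\<close> cannot involve \<open>y\<close>,
  as \<open>f \<notin> S\<close>. So either it involves a generator \<open>k\<close> other than \<open>y\<close> and \<open>z\<close>, and \<open>f + y = k + s\<close>
  with \<open>s \<in> S\<close>, or \<open>f + y = a z\<close>; then \<open>a \<ge> 1\<close>, so \<open>f + y - z \<in> S\<close>. In this second case the partner \<open>F - f\<close> is used with \<open>z\<close>
  instead: a factorization of \<open>F - f + z\<close> involves neither \<open>z\<close>, as \<open>F - f \<notin> S\<close>, nor \<open>y\<close>, since
  otherwise \<open>F = (f + y - z) + (F - f + z - y)\<close> would be a sum of two elements of \<open>S\<close>. Hence it
  involves a third generator \<open>k\<close>, and \<open>F - f + z = k + s\<close>. In both cases \<open>s < F\<close>, because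
  \<open>y, z < k\<close>.

  This attaches to every \<open>f \<in> L\<close> one of the \<open>(e - 2) n\<close> pairs \<open>(k, s)\<close>, and no pair is used twice.
  The only doubtful case is a pair obtained from \<open>f\<close> in the first way and from \<open>f'\<close> in the second.
  Then \<open>f + y = F - f' + z\<close> and \<open>f' + y = a z\<close>, where \<open>a \<ge> 1\<close> since \<open>f' > 0\<close>,
  so \<open>f + (a - 1) z = F\<close>. For \<open>a > 1\<close> the left side
  lies in \<open>S\<close>, because \<open>f\<close> is pseudo-Frobenius; for \<open>a = 1\<close> it says \<open>f = F\<close>, but \<open>F\<close> is not in \<open>L\<close>,
  as \<open>F - F \<in> S\<close>.
\<close>

definition unpaired :: "nat set \<Rightarrow> int set" where
  "unpaired S = {x. x \<notin> int ` S \<and> frobenius_number S - x \<notin> int ` S}"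

lemma unpaired_subset_interval:
  assumes "numerical_semigroup S"
  shows "unpaired S \<subseteq> {1..<frobenius_number S}"
proof
  fix x assume x: "x \<in> unpaired S"
  have zero: "0 \<in> int ` S"
    using assms by (force simp: numerical_semigroup_def)
  have "x \<le> frobenius_number S" "frobenius_number S - x \<le> frobenius_number S"
    using x frobenius_number_greatest(2)[OF assms] by (auto simp: unpaired_def)
  moreover have "x \<noteq> 0" "x \<noteq> frobenius_number S"
    using x zero by (auto simp: unpaired_def)
  ultimately show "x \<in> {1..<frobenius_number S}" by auto
qed

lemma unpaired_reflect: "x \<in> unpaired S \<Longrightarrow> frobenius_number S - x \<in> unpaired S"
  by (simp add: unpaired_def)

lemma unpaired_subset_pseudo_frobenius:
  "almost_symmetric S \<Longrightarrow> unpaired S \<subseteq> pseudo_frobenius S"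
  by (auto simp: almost_symmetric_def unpaired_def)

text \<open>The map \<open>x \<mapsto> F - x\<close> sends the elements of \<open>S\<close> in \<open>{0..F}\<close> to gaps, because \<open>F\<close> is not a sum of
  two elements of \<open>S\<close>; the integers in \<open>{0..F}\<close> that are left over are the unpaired ones.\<close>

lemma frobenius_number_eq_two_card_plus_card_unpaired:
  assumes S: "numerical_semigroup S"
  shows "frobenius_number S + 1 =
    2 * int (card (int ` S \<inter> {0..frobenius_number S})) + int (card (unpaired S))"
proof -
  let ?F = "frobenius_number S"
  let ?N = "int ` S \<inter> {0..?F}"
  let ?R = "(\<lambda>x. ?F - x) ` ?N"
  have add: "a + b \<in> int ` S" if "a \<in> int ` S" "b \<in> int ` S" for a b
    using S that by (force simp: numerical_semigroup_def simp flip: of_nat_add)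
  have disj: "?N \<inter> ?R = {}"
  proof (rule ccontr)
    assume "?N \<inter> ?R \<noteq> {}"
    then obtain x where "x \<in> int ` S" "?F - x \<in> int ` S" by auto
    from add[OF this] show False using frobenius_number_greatest(1)[OF S] by simp
  qed
  have split: "{0..?F} = (?N \<union> ?R) \<union> unpaired S"
    using unpaired_subset_interval[OF S] by (force simp: unpaired_def image_iff)
  have disj': "(?N \<union> ?R) \<inter> unpaired S = {}"
    by (auto simp: unpaired_def)
  have fin: "finite ?N" "finite ?R" by simp_all
  have fin': "finite (unpaired S)"
    using unpaired_subset_interval[OF S] by (rule finite_subset) simp
  have "card {0..?F} = card (?N \<union> ?R) + card (unpaired S)"
    using card_Un_disjoint[OF _ fin' disj'] fin by (simp flip: split)
  moreover have "card (?N \<union> ?R) = card ?N + card ?R"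
    using fin disj by (intro card_Un_disjoint)
  moreover have "card ?R = card ?N"
    by (rule card_image) (auto simp: inj_on_def)
  moreover have "- 1 \<notin> int ` S" by auto
  hence "int (card {0..?F}) = ?F + 1"
    using frobenius_number_greatest(2)[OF S, of "- 1"] by simp
  ultimately show ?thesis by linarith
qed

lemma multiple_in_submonoid_span:
  assumes "x \<in> A"
  shows "c * x \<in> submonoid_span A"
  unfolding submonoid_span_def
  by (rule CollectI, rule exI[of _ "\<lambda>_. c"], rule exI[of _ "{x}"]) (simp add: assms)

text \<open>A factorization either uses a generator besides \<open>y\<close> and \<open>z\<close>, which may be split off once, or is
  a combination of \<open>y\<close> and \<open>z\<close> alone.\<close>

lemma submonoid_span_split_off:
  assumes "s \<in> submonoid_span A"
  obtains (other) k r where "k \<in> A - {y, z}" "r \<in> submonoid_span A" "s = k + r"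
    | (pair) b c where "s = b * y + c * z"
proof -
  obtain a B where B: "finite B" "B \<subseteq> A" and s: "s = (\<Sum>x\<in>B. a x * x)"
    using assms by (auto simp: submonoid_span_def)
  show thesis
  proof (cases "\<exists>k\<in>B - {y, z}. a k > 0")
    case True
    then obtain k where k: "k \<in> B" "k \<notin> {y, z}" "a k > 0" by auto
    define a' where "a' = a(k := a k - 1)"
    have rest: "(\<Sum>x\<in>B - {k}. a x * x) = (\<Sum>x\<in>B - {k}. a' x * x)"
      by (rule sum.cong) (auto simp: a'_def)
    have "a k * k = k + a' k * k"
      using k(3) by (cases "a k") (auto simp: a'_def)
    hence "s = k + (\<Sum>x\<in>B. a' x * x)"
      unfolding s using B(1) k(1) rest by (simp add: sum.remove[of B k])
    moreover have "(\<Sum>x\<in>B. a' x * x) \<in> submonoid_span A"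
      using B by (auto simp: submonoid_span_def)
    ultimately show thesis using other k B by blast
  next
    case False
    have "s = (\<Sum>x\<in>{y, z} \<inter> B. a x * x)"
      unfolding s using B(1) False by (intro sum.mono_neutral_right) force+
    also have "\<dots> = (\<Sum>x\<in>{y, z}. (if x \<in> B then a x else 0) * x)"
      by (subst sum.inter_restrict) (auto intro!: sum.cong)
    finally have s': "s = \<dots>" .
    show thesis
    proof (cases "y = z")
      case True
      thus thesis using pair[of "if y \<in> B then a y else 0" 0] s' by simp
    next
      case False
      thus thesis
        using pair[of "if y \<in> B then a y else 0" "if z \<in> B then a z else 0"] s' by simp
    qed
  qed
qed

text \<open>Positivity of the generators matters because a pseudo-Frobenius number is only known to be
  moved into \<open>S\<close> by nonzero elements.\<close>

lemma minimal_generating_system_zero_notin: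
  assumes "minimal_generating_system A S"
  shows "0 \<notin> A"
proof
  assume "0 \<in> A"
  have "submonoid_span A \<subseteq> submonoid_span (A - {0})"
  proof
    fix s assume "s \<in> submonoid_span A"
    then obtain a B where B: "finite B" "B \<subseteq> A" "s = (\<Sum>x\<in>B. a x * x)"
      by (auto simp: submonoid_span_def)
    have "s = (\<Sum>x\<in>B - {0}. a x * x)"
      unfolding B(3) using B(1) by (intro sum.mono_neutral_right) auto
    moreover have "finite (B - {0})" "B - {0} \<subseteq> A - {0}" using B by auto
    ultimately show "s \<in> submonoid_span (A - {0})"
      unfolding submonoid_span_def by blast
  qed
  moreover have "submonoid_span (A - {0}) \<subseteq> submonoid_span A"
    by (auto simp: submonoid_span_def)
  ultimately show False
    using assms \<open>0 \<in> A\<close> unfolding minimal_generating_system_def by blast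
qed

text \<open>The relation \<open>r\<close> attaches to \<open>f\<close> the pairs \<open>(k, s)\<close> described at the beginning. It need not be
  a function of \<open>f\<close>; for the count it suffices that every \<open>f\<close> is related to some pair and that no pair
  is related to two different \<open>f\<close>.\<close>

lemma card_unpaired_le:
  assumes S: "numerical_semigroup S"
    and AS: "almost_symmetric S"
    and A: "finite A" "submonoid_span A = S"
    and y: "y \<in> A" "0 < y"
    and z: "z \<in> A" "y < z"
    and least: "\<And>k. k \<in> A - {y, z} \<Longrightarrow> z < k"
  shows "card (unpaired S) \<le> card (A - {y, z}) * card (int ` S \<inter> {0..frobenius_number S})"
proof -
  let ?F = "frobenius_number S"
  let ?T = "int ` S"
  define r where "r = (\<lambda>f (k, s). f + int y = int k + s \<or>
    (\<exists>a. f + int y = int a * int z) \<and> ?F - f + int z = int k + s)"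
  have F: "?F \<notin> ?T" by (rule frobenius_number_greatest(1)[OF S])
  have add: "a + b \<in> ?T" if "a \<in> ?T" "b \<in> ?T" for a b
    using S that by (force simp: numerical_semigroup_def simp flip: of_nat_add)
  have mult: "int c * int x \<in> ?T" if "x \<in> A" for c x
    using multiple_in_submonoid_span[OF that, of c] A(2) by (metis imageI of_nat_mult)
  have gap: "f \<notin> ?T" "0 < f" "f < ?F" if "f \<in> unpaired S" for f
    using that unpaired_subset_interval[OF S] by (auto simp: unpaired_def)
  have pf: "f + int s \<in> ?T" if "f \<in> unpaired S" "s \<in> S" "0 < s" for f s
    using that unpaired_subset_pseudo_frobenius[OF AS] by (auto simp: pseudo_frobenius_def)
  have gen: "x \<in> S" if "x \<in> A" for x
    using multiple_in_submonoid_span[OF that, of 1] A(2) by simp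
  have factorize: "(\<exists>k\<in>A - {y, z}. \<exists>s\<in>?T. x = int k + s) \<or>
      (\<exists>b c. x = int b * int y + int c * int z)" if x: "x \<in> ?T" for x
  proof -
    obtain w where w: "x = int w" "w \<in> submonoid_span A" using x A(2) by blast
    from w(2) show ?thesis
    proof (cases rule: submonoid_span_split_off[where y = y and z = z])
      case (other k q)
      have "int q \<in> ?T" "x = int k + int q" using other w(1) A(2) by auto
      thus ?thesis using other(1) by blast
    next
      case (pair b c)
      have "x = int b * int y + int c * int z" using pair w(1) by simp
      thus ?thesis by blast
    qed
  qed
  have ex: "\<exists>p. p \<in> (A - {y, z}) \<times> (?T \<inter> {0..?F}) \<and> r f p" if f: "f \<in> unpaired S" for f
  proof -
    have admissible: ?thesis
      if "k \<in> A - {y, z}" "s \<in> ?T" "r f (k, s)" for k s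
    proof -
      have "?F - f < ?F" "f < ?F" "y < k" "z < k"
        using gap[OF f] least[OF that(1)] z(2) by auto
      hence "s \<in> {0..?F}" using that(2,3) by (auto simp: r_def)
      thus ?thesis using that by blast
    qed
    have "f + int y \<in> ?T" using pf[OF f] gen y by blast
    from factorize[OF this] show ?thesis
    proof (elim disjE bexE exE)
      fix k s assume "k \<in> A - {y, z}" "s \<in> ?T" "f + int y = int k + s"
      thus ?thesis using admissible by (auto simp: r_def)
    next
      fix b c assume bc: "f + int y = int b * int y + int c * int z"
      \<comment> \<open>A summand \<open>y\<close> on the right would cancel and put the gap \<open>f\<close> into \<open>S\<close>.\<close>
      have "b = 0"
      proof (rule ccontr)
        assume "b \<noteq> 0"
        then obtain b' where "b = Suc b'" by (cases b) auto
        hence "f = int b' * int y + int c * int z" using bc by (simp add: algebra_simps)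
        thus False using add mult y(1) z(1) gap(1)[OF f] by metis
      qed
      with bc have c: "f + int y = int c * int z" by simp
      then obtain c' where c': "c = Suc c'" using gap(2)[OF f] by (cases c) auto
      have f': "?F - f \<in> unpaired S" by (rule unpaired_reflect[OF f])
      have "?F - f + int z \<in> ?T" using pf[OF f'] gen z by force
      from factorize[OF this] show ?thesis
      proof (elim disjE bexE exE)
        fix k s assume "k \<in> A - {y, z}" "s \<in> ?T" "?F - f + int z = int k + s"
        thus ?thesis using admissible c by (auto simp: r_def)
      next
        fix b d assume bd: "?F - f + int z = int b * int y + int d * int z"
        show ?thesis
        proof (cases b)
          case (Suc b')
          \<comment> \<open>Both \<open>f + y - z = c' z\<close> and \<open>F - f + z - y\<close> lie in \<open>S\<close>, and they add up to \<open>F\<close>.\<close>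
          have "?F = int c' * int z + (int b' * int y + int d * int z)"
            using bd c c' Suc by (simp add: algebra_simps)
          hence False using add mult y(1) z(1) F by metis
          thus ?thesis ..
        next
          case 0
          show ?thesis
          proof (cases d)
            case (Suc d')
            hence "?F - f = int d' * int z" using bd 0 by (simp add: algebra_simps)
            hence False using mult[OF z(1)] gap(1)[OF f'] by metis
            thus ?thesis ..
          next
            case d: 0
            hence "?F - f + int z = 0" using bd 0 by simp
            hence False using gap(2)[OF f'] by linarith
            thus ?thesis ..
          qed
        qed
      qed
    qed
  qed
  have clash: False
    if f: "f \<in> unpaired S" "f' \<in> unpaired S" "f + int y = ?F - f' + int z"
      "f' + int y = int a * int z" for f f' a
  proof -
    obtain a' where a': "a = Suc a'" using f(4) gap(2)[OF f(2)] by (cases a) auto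
    have eq: "?F = f + int (a' * z)" using f(3,4) a' by (simp add: algebra_simps)
    have "a' \<noteq> 0" using eq gap(3)[OF f(1)] by (cases a') auto
    moreover have "a' * z \<in> S" using multiple_in_submonoid_span[OF z(1)] A(2) by simp
    ultimately have "f + int (a' * z) \<in> ?T" using z(2) by (intro pf[OF f(1)]) auto
    hence "?F \<in> ?T" using eq by simp
    thus False using F by simp
  qed
  have inj: "f = f'"
    if "f \<in> unpaired S" "f' \<in> unpaired S" "r f p" "r f' p" for f f' p
  proof (cases p)
    case (Pair k s)
    from that(3,4) show ?thesis unfolding r_def Pair prod.case
    proof (elim disjE conjE exE)
      fix a assume "f + int y = int k + s" "?F - f' + int z = int k + s" "f' + int y = int a * int z"
      thus ?thesis using clash[OF that(1,2), of a] by simp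
    next
      fix a assume "f' + int y = int k + s" "?F - f + int z = int k + s" "f + int y = int a * int z"
      thus ?thesis using clash[OF that(2,1), of a] by simp
    qed simp_all
  qed
  have "finite ((A - {y, z}) \<times> (?T \<inter> {0..?F}))" using A(1) by simp
  from card_le_if_inj_on_rel[OF this, of "unpaired S" r, OF ex inj]
  show ?thesis by (simp add: card_cartesian_product)
qed

theorem corollary4:
  fixes S :: "nat set" and g :: "nat \<Rightarrow> nat" and e n :: nat and F :: int
  assumes "numerical_semigroup S"
    and "almost_symmetric S"
    and "e \<ge> 2"
    and "strict_mono_on {1..e} g"
    and "minimal_generating_system (g ` {1..e}) S"
    and "F = frobenius_number S"
    and "n = card (int ` S \<inter> {0..F})"
  shows "F + 1 \<le> int e * int n"
proof -
  let ?A = "g ` {1..e}"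
  have mono: "g i < g j" if "1 \<le> i" "i < j" "j \<le> e" for i j
    using strict_mono_onD[OF assms(4)] that by auto
  have A: "g 1 \<in> ?A" "g 2 \<in> ?A" "g 1 < g 2"
    using assms(3) mono by auto
  have pos: "0 < g 1"
    using minimal_generating_system_zero_notin[OF assms(5)] A(1) by (metis gr0I)
  have least: "g 2 < k" if k: "k \<in> ?A - {g 1, g 2}" for k
  proof -
    obtain i where i: "i \<in> {1..e}" "k = g i" "i \<noteq> 1" "i \<noteq> 2" using k by blast
    thus ?thesis using mono[of 2 i] by simp
  qed
  have "card ?A = e"
    using strict_mono_on_imp_inj_on[OF assms(4)] by (simp add: card_image)
  hence others: "card (?A - {g 1, g 2}) = e - 2"
    using A by (simp add: card_Diff_subset)
  have "card (unpaired S) \<le> (e - 2) * n"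
    using card_unpaired_le[OF assms(1,2) _ _ A(1) pos A(2,3) least] assms(5-7) others
    by (simp add: minimal_generating_system_def)
  hence "int (card (unpaired S)) \<le> int (e - 2) * int n"
    by (simp flip: of_nat_mult)
  moreover have "F + 1 = 2 * int n + int (card (unpaired S))"
    using frobenius_number_eq_two_card_plus_card_unpaired[OF assms(1)] assms(6,7) by simp
  ultimately show ?thesis
    using assms(3) by (simp add: of_nat_diff algebra_simps)
qed

end
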